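(* Suppose that $\mathcal{U}$ is a compact subset of $\mathbb{R}^m$ for some $m\in\mathbb{N}$, and that the deterministic and random solution operators $S,S_N:\mathcal{U}\to C([0,T];\mathbb{R}^d)$ are continuous maps. Let $2<\rho^\ast<\infty$ be arbitrary. Suppose that $e(0;u)=0$, and that the following three assumptions hold: (A1) (exact flow) there are $0<\tau^\ast\le 1$ and $C_F\ge 1$ such that for $0<\tau<\tau^\ast$ the flow map $F^\tau:\mathbb{R}^d\to\mathbb{R}^d$ satisfies $\|F^\tau(z_0)-F^\tau(v_0)\|\le (1+C_F\tau)\|z_0-v_0\|$ for all $z_0,v_0\in\mathbb{R}^d$; (A2) (numerical flow) the numerical method $\Psi^\tau$ has uniform local truncation error of order $q+1$: for some constant $C_\Psi\ge 1$ that does not depend on $\tau$, $\sup_{v\in\mathbb{R}^d}\|\Psi^\tau(v)-F^\tau(v)\|\le C_\Psi\tau^{q+1}$; (A3) (noise, with $R=+\infty$) there are $p\ge 1$ and $C_{\xi,R}\ge 1$, independent of $k$ and $\tau$, such that for all $1\le r<\infty$ and all $k$, $\mathbb{E}_{\nu_N}\left[\sup_{0<t\le T/N}\|\xi_k(t)\|^r\right]\le \left(C_{\xi,R}\,(T/N)^{p+1/2}\right)^r$; and that the parameters $\tau^\ast,C_F,C_\Psi,q,R=+\infty,C_{\xi,R},p$ depend continuously on $u\in\mathcal{U}$ (parameters not depending on $u$ are allowed). Then, for $N\in\mathbb{N}$ such that $T/\tau^\ast<N$, the following hold: (a) there exists some $C>0$ that does not depend on $N$ such that $$ d_{\mathrm{H}}(\mu,\mu_N^{\mathrm{M}})\le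 C\left\|\mathbb{E}_{\nu_N}\left[\|G_N-G\|^{2r_1}\right]^{1/r_1}\right\|^{1/2}_{L^{r_2}_{\mu_0}(\mathcal{U})}\quad\text{with } r_1=1,\ r_2=\frac{2\rho^\ast}{\rho^\ast-1};$$ (b) there exists some $D>0$ that does not depend on $N$ such that $$ \mathbb{E}_{\nu_N}\left[d_{\mathrm{H}}(\mu,\mu_N^{\mathrm{S}})^2\right]^{1/2}\le D\left\|\mathbb{E}_{\nu_N}\left[\|G_N-G\|^{2s_1}\right]^{1/s_1}\right\|^{1/2}_{L^{s_2}_{\mu_0}(\mathcal{U})}\quad\text{with } s_1=\frac{2\rho^\ast}{\rho^\ast-2},\ s_2=2.$$
   Context: Fix $T>0$. For each parameter $u\in\mathcal{U}$, $(z(t;u))_{t\in[0,T]}$ solves the ODE $\frac{d}{dt}z(t;u)=f(z(t;u);u)$, $z(0;u)=z_0(u)$, in $\mathbb{R}^d$, and $S(u):=(z(t;u))_{t\in[0,T]}\in C([0,T];\mathbb{R}^d)$ (supremum norm). The flow $F^\tau$ (depending on $u$) is defined by $F^\tau(a)=a+\int_0^\tau f(F^t(a);u)\,dt$. For $N\in\mathbb{N}$ let $\tau=T/N$ and $t_k=k\tau$, $k=0,\dots,N$. $\Psi^\tau:\mathbb{R}^d\to\mathbb{R}^d$ is the numerical flow map (depending on $u$ via $f$) of a one-step integrator with step $\tau$. Let $\xi_k:\Omega\times[0,\tau]\to\mathbb{R}^d$ be stochastic processes with almost surely continuous paths, not depending on $u$; $\nu_N$ denotes the (joint) distribution of the $\xi_k$'s.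 The randomised integrator is $$Z(t_{k+1};u):=\Psi^\tau(Z(t_k;u))+\xi_k(\tau),\qquad Z(t;u):=\Psi^{t-t_k}(Z(t_k;u))+\xi_k(t-t_k)\ \text{ for } t_k<t<t_{k+1},$$ and $S_N(u):=(Z(t;u))_{t\in[0,T]}$ is the random solution operator (almost surely in $C([0,T];\mathbb{R}^d)$). The error process is $e(t;u):=z(t;u)-Z(t;u)$. Let $T_J=(t_j)_{j\in J}\subset[0,T]$ be a fixed strictly increasing sequence of observation times, with finite non-empty index set $J$ of cardinality $|J|$, let $\mathcal{Y}:=\mathbb{R}^{d|J|}$ with the Euclidean norm, and let $O:C([0,T];\mathbb{R}^d)\to\mathcal{Y}$, $O(\tilde z):=(\tilde z(t_j))_{t_j\in T_J}$. The forward models are $G:=O\circ S$ and $G_N:=O\circ S_N$. For fixed $y\in\mathcal{Y}$ and a fixed symmetric positive-definite matrix $\Gamma$, $\Phi(u)=\frac12\|\Gamma^{-1/2}(G(u)-y)\|^2$ and $\Phi_N(u)=\frac12\|\Gamma^{-1/2}(G_N(u)-y)\|^2$. $\mu_0$ is a probability measure (prior) on $\mathcal{U}$, and the noise is independent of $u$. $\mathbb{E}_{\nu_N}$ is integration over the noise only. With $Z:=\mathbb{E}_{\mu_0}[\exp(-\Phi)]\in(0,\infty)$ and $Z_N^{\mathrm{S}}:=\mathbb{E}_{\mu_0}[\exp(-\Phi_N)]$ (a random variable), the exact posterior $\mu$, the sample approximate posterior $\mu_N^{\mathrm{S}}$ (a random measure) and the marginal approximate posterior $\mu_N^{\mathrm{M}}$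 are $$\frac{d\mu}{d\mu_0}=\frac{e^{-\Phi}}{Z},\qquad \frac{d\mu_N^{\mathrm{S}}}{d\mu_0}=\frac{e^{-\Phi_N}}{Z_N^{\mathrm{S}}},\qquad \frac{d\mu_N^{\mathrm{M}}}{d\mu_0}=\frac{\mathbb{E}_{\nu_N}[e^{-\Phi_N}]}{\mathbb{E}_{\nu_N}[Z_N^{\mathrm{S}}]}.$$ The Hellinger distance of probability measures $\mu,\nu$ absolutely continuous with respect to a reference measure $\pi$ is $d_{\mathrm{H}}(\mu,\nu)^2 := \frac12\int_{\mathcal{U}} \left| \sqrt{d\mu/d\pi}-\sqrt{d\nu/d\pi}\right|^2 d\pi$. Conventions: $\tau^\ast$ may depend on $u$; the condition $T/\tau^\ast<N$ is meant for all $u\in\mathcal{U}$, and the truncation error bound (A2) is meant for step sizes $0<\tau<\tau^\ast$. *)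

theory Defs
  imports "HOL-Probability.Probability"
begin

(* The noise lives on a probability space P and enters as xi N k \<omega> t; the law \<nu>_N of
   (xi N k)_k is a pushforward of P, so expectation under \<nu>_N is integration over P.
   The noise is not a function of the parameter u, and the prior is a separate measure mu0:
   iterated integrals over P and mu0 express the independence of noise and parameter.
   Nonnegative integrals are taken in ennreal, so that infinite values keep their meaning. *)

definition enn_powr :: "ennreal \<Rightarrow> real \<Rightarrow> ennreal" where  (* meant for exponents a > 0 *)
  "enn_powr x a = (if x = \<top> then \<top> else ennreal (enn2real x powr a))"

definition Lr_norm :: "'a measure \<Rightarrow> real \<Rightarrow> ('a \<Rightarrow> ennreal) \<Rightarrow> ennreal" where
  "Lr_norm M r g = enn_powr (\<integral>\<^sup>+ x. enn_powr (g x) r \<partial>M) (1 / r)"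

(* Elements are functions on the reals that are "undefined" outside {0..T}. *)
definition path_space :: "real \<Rightarrow> (real \<Rightarrow> 'a::metric_space) metric" where
  "path_space T = cfunspace (top_of_set {0..T}) euclidean_metric"

definition solution_op :: "real \<Rightarrow> ('u \<Rightarrow> real \<Rightarrow> 'a) \<Rightarrow> 'u \<Rightarrow> real \<Rightarrow> 'a" where
  "solution_op T z u = restrict (z u) {0..T}"

(* psi h is the numerical flow map with step h, x k the k-th noise path, a the initial value;
   the value is the k-th grid point iterate for the step size tau. *)
primrec grid_value ::
  "(real \<Rightarrow> 'a \<Rightarrow> 'a) \<Rightarrow> (nat \<Rightarrow> real \<Rightarrow> 'a) \<Rightarrow> real \<Rightarrow> 'a \<Rightarrow> nat \<Rightarrow> 'a::plus" where
  "grid_value psi x tau a 0 = a"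
| "grid_value psi x tau a (Suc k) = psi tau (grid_value psi x tau a k) + x k tau"

(* For t \<ge> 0, k is the index with k * tau \<le> t < (k + 1) * tau. *)
definition randomised_path ::
  "real \<Rightarrow> nat \<Rightarrow> (real \<Rightarrow> 'a \<Rightarrow> 'a) \<Rightarrow> (nat \<Rightarrow> real \<Rightarrow> 'a) \<Rightarrow> 'a \<Rightarrow> real \<Rightarrow> 'a::plus" where
  "randomised_path T N psi x a t =
    (let tau = T / real N; k = nat \<lfloor>t / tau\<rfloor> in
      if t = real k * tau then grid_value psi x tau a k
      else psi (t - real k * tau) (grid_value psi x tau a k) + x k (t - real k * tau))"

(* The index type 'd \<times> 'j has d * |J| elements. *)
definition observe ::
  "('j \<Rightarrow> real) \<Rightarrow> (real \<Rightarrow> real ^ 'd) \<Rightarrow> real ^ ('d::finite \<times> 'j::finite)" where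
  "observe tobs w = (\<chi> ij. w (tobs (snd ij)) $ fst ij)"

definition sym_posdef :: "real ^ 'n ^ 'n \<Rightarrow> bool" where
  "sym_posdef A \<longleftrightarrow> transpose A = A \<and> (\<forall>x. x \<noteq> 0 \<longrightarrow> 0 < x \<bullet> (A *v x))"

definition matrix_sqrt :: "real ^ 'n ^ 'n \<Rightarrow> real ^ 'n ^ 'n" where
  "matrix_sqrt A = (THE B. sym_posdef B \<and> B ** B = A)"

definition misfit ::
  "real ^ 'n ^ 'n \<Rightarrow> real ^ 'n \<Rightarrow> ('u \<Rightarrow> real ^ 'n) \<Rightarrow> 'u \<Rightarrow> real" where
  "misfit \<Gamma> y G u = 1 / 2 * (norm (matrix_sqrt (matrix_inv \<Gamma>) *v (G u - y)))\<^sup>2"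

definition evidence :: "'u measure \<Rightarrow> ('u \<Rightarrow> real) \<Rightarrow> ennreal" where
  "evidence mu0 \<Phi> = (\<integral>\<^sup>+ u. ennreal (exp (- \<Phi> u)) \<partial>mu0)"

(* Exact posterior; with \<Phi> replaced by a realisation of the random misfit, this is the
   sample approximate posterior. *)
definition posterior :: "'u measure \<Rightarrow> ('u \<Rightarrow> real) \<Rightarrow> 'u measure" where
  "posterior mu0 \<Phi> = density mu0 (\<lambda>u. ennreal (exp (- \<Phi> u)) / evidence mu0 \<Phi>)"

definition marginal_posterior ::
  "'w measure \<Rightarrow> 'u measure \<Rightarrow> ('w \<Rightarrow> 'u \<Rightarrow> real) \<Rightarrow> 'u measure" where
  "marginal_posterior P mu0 \<Phi>N = density mu0
    (\<lambda>u. (\<integral>\<^sup>+ \<omega>. ennreal (exp (- \<Phi>N \<omega> u)) \<partial>P) / (\<integral>\<^sup>+ \<omega>. evidence mu0 (\<Phi>N \<omega>) \<partial>P))"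

definition hellinger :: "'u measure \<Rightarrow> 'u measure \<Rightarrow> 'u measure \<Rightarrow> real" where
  "hellinger \<pi> \<mu> \<nu> = sqrt (1 / 2 *
    (\<integral> u. (\<bar>sqrt (enn2real (RN_deriv \<pi> \<mu> u)) - sqrt (enn2real (RN_deriv \<pi> \<nu> u))\<bar>)\<^sup>2 \<partial>\<pi>))"

(* || E[ ||G_N - G||^(2r) ]^(1/r) ||^(1/2), the outer norm being that of L^s(mu0). *)
definition forward_error ::
  "'w measure \<Rightarrow> 'u measure \<Rightarrow> ('u \<Rightarrow> 'y::real_normed_vector) \<Rightarrow> ('w \<Rightarrow> 'u \<Rightarrow> 'y)
    \<Rightarrow> real \<Rightarrow> real \<Rightarrow> ennreal" where
  "forward_error P mu0 G GN r s = enn_powr (Lr_norm mu0 s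
    (\<lambda>u. enn_powr (\<integral>\<^sup>+ \<omega>. ennreal (norm (GN \<omega> u - G u) powr (2 * r)) \<partial>P) (1 / r))) (1 / 2)"

definition admissible :: "real \<Rightarrow> 'u set \<Rightarrow> ('u \<Rightarrow> real) \<Rightarrow> nat \<Rightarrow> bool" where
  "admissible T U taus N \<longleftrightarrow> 0 < N \<and> (\<forall>u\<in>U. T / taus u < real N)"

end

theory Submission
  imports Defs
begin

text \<open>
  Write \<open>a = exp (- \<Phi> / 2)\<close> and \<open>b = exp (- \<Phi>\<^sub>N / 2)\<close> for the square roots of the unnormalised
  likelihoods, called amplitudes below. The Hellinger distance of two posteriors is, up to a factor, the
  distance in \<open>L\<^sup>2(\<mu>\<^sub>0)\<close> of the normalised amplitudes, and elementary geometry of that Hilbert space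
  bounds its square by \<open>\<parallel>a - b\<parallel>\<^sup>2 / \<parallel>a\<parallel>\<^sup>2\<close> (\<open>hellinger_normalised_amplitudes\<close>). Here
  \<open>\<parallel>a\<parallel>\<^sup>2\<close> is the evidence of the exact posterior, a positive constant independent of \<open>N\<close>.

  The amplitude is a Gaussian function of the model output and hence globally Lipschitz
  (\<open>amplitude_lipschitz\<close>), so \<open>|a - b| \<le> L \<parallel>G\<^sub>N - G\<parallel>\<close> pointwise. For the sample posterior, integration
  over the noise and Tonelli's theorem bound the mean squared Hellinger distance by a multiple of
  the mean of \<open>\<parallel>G\<^sub>N - G\<parallel>\<^sup>2\<close> over noise and prior. The amplitude of the marginal posterior is the root of the second moment of
  the random variable \<open>b\<close>, and by the reverse triangle inequality in \<open>L\<^sup>2\<close> of the noise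
  (\<open>root_second_moment_diff_le\<close>) it obeys the same bound. Since all integrals are over
  probability measures, Jensen's inequality replaces this mean square error by the mixed norms of the
  statement, for all exponents that are at least 1 (\<open>mean_square_error_le_forward_error\<close>).

  The continuity of the solution operators in the parameter enters through joint measurability: the
  random forward model is measurable in the noise and, up to a null set, continuous in the parameter
  (\<open>caratheodory_jointly_measurable\<close>).
\<close>

section \<open>Gaussian amplitudes\<close>

lemma gaussian_amplitude_lipschitz:
  fixes s t :: real
  shows "\<bar>exp (- (s\<^sup>2 / 4)) - exp (- (t\<^sup>2 / 4))\<bar> \<le> \<bar>s - t\<bar>"
proof -
  have "norm (exp (- (s\<^sup>2 / 4)) - exp (- (t\<^sup>2 / 4))) \<le> 1 * norm (s - t)"
  proof (rule field_differentiable_bound[where S = UNIV and f' = "\<lambda>x. - (x / 2) * exp (- (x\<^sup>2 / 4))"])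
    fix x :: real
    show "((\<lambda>x. exp (- (x\<^sup>2 / 4))) has_field_derivative - (x / 2) * exp (- (x\<^sup>2 / 4))) (at x within UNIV)"
      by (auto intro!: derivative_eq_intros)
    \<comment> \<open>With v = |x/2|, the derivative is at most v exp(-v^2), and v \<le> 1 + v^2 \<le> exp(v^2).\<close>
    have "\<bar>x / 2\<bar> \<le> 1 + x\<^sup>2 / 4"
      using zero_le_power2[of "\<bar>x\<bar> / 2 - 1"] zero_le_power2[of x]
      by (auto simp: power2_diff power_divide)
    also have "\<dots> \<le> exp (x\<^sup>2 / 4)"
      by (rule exp_ge_add_one_self)
    finally have "\<bar>x / 2\<bar> * exp (- (x\<^sup>2 / 4)) \<le> 1"
      by (simp add: exp_minus field_simps)
    then show "norm (- (x / 2) * exp (- (x\<^sup>2 / 4))) \<le> 1"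
      by (simp add: abs_mult)
  qed auto
  then show ?thesis by simp
qed

text \<open>
  The square root of the unnormalised likelihood of the data as a function of the model output. Since
  the Hellinger distance compares square roots of densities, it is this function rather than the
  misfit that has to be controlled.
\<close>
definition amplitude :: "real ^ 'n ^ 'n \<Rightarrow> real ^ 'n \<Rightarrow> real ^ 'n \<Rightarrow> real" where
  "amplitude \<Gamma> y g = exp (- (norm (matrix_sqrt (matrix_inv \<Gamma>) *v (g - y)))\<^sup>2 / 4)"

lemma exp_misfit_eq_amplitude_squared: "exp (- misfit \<Gamma> y G u) = (amplitude \<Gamma> y (G u))\<^sup>2"
  by (simp add: misfit_def amplitude_def flip: exp_double)

lemma posterior_eq_normalised_amplitude:
  "posterior mu0 (misfit \<Gamma> y G) = density mu0
    (\<lambda>u. ennreal ((amplitude \<Gamma> y (G u))\<^sup>2) / (\<integral>\<^sup>+u. ennreal ((amplitude \<Gamma> y (G u))\<^sup>2) \<partial>mu0))"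
  by (simp add: posterior_def evidence_def exp_misfit_eq_amplitude_squared)

lemma amplitude_pos: "0 < amplitude \<Gamma> y g"
  by (simp add: amplitude_def)

lemma amplitude_le_1: "amplitude \<Gamma> y g \<le> 1"
  by (simp add: amplitude_def)

lemma measurable_amplitude [measurable]: "amplitude \<Gamma> y \<in> borel_measurable borel"
  unfolding amplitude_def
  by (intro borel_measurable_continuous_onI continuous_intros
      bounded_linear.continuous_on[OF matrix_vector_mul_bounded_linear]) auto

text \<open>
  The misfit itself is only locally Lipschitz in the model output, but the tails of the Gaussian damp
  its growth. One constant thus serves all realisations of the random forward model, however large
  their values.
\<close>
lemma amplitude_lipschitz:
  fixes \<Gamma> :: "real ^ 'n ^ 'n"
  obtains L where "0 < L" "\<And>g h. \<bar>amplitude \<Gamma> y g - amplitude \<Gamma> y h\<bar> \<le> L * norm (h - g)"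
proof -
  let ?M = "(*v) (matrix_sqrt (matrix_inv \<Gamma>))"
  obtain L where L: "0 < L" "\<And>x. norm (?M x) \<le> norm x * L"
    using bounded_linear.pos_bounded[OF matrix_vector_mul_bounded_linear] by metis
  have "\<bar>amplitude \<Gamma> y g - amplitude \<Gamma> y h\<bar> \<le> L * norm (h - g)" for g h
  proof -
    have "\<bar>amplitude \<Gamma> y g - amplitude \<Gamma> y h\<bar> \<le> \<bar>norm (?M (g - y)) - norm (?M (h - y))\<bar>"
      unfolding amplitude_def minus_divide_left[symmetric] by (rule gaussian_amplitude_lipschitz)
    also have "\<dots> \<le> norm (?M (g - y) - ?M (h - y))"
      by (rule norm_triangle_ineq3)
    also have "?M (g - y) - ?M (h - y) = ?M (g - h)"
      by (simp flip: matrix_vector_mult_diff_distrib)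
    also have "norm \<dots> \<le> L * norm (h - g)"
      using L(2)[of "g - h"] by (simp add: mult.commute norm_minus_commute)
    finally show ?thesis .
  qed
  with L(1) show ?thesis by (rule that)
qed

section \<open>The Hellinger distance of normalised amplitudes\<close>

lemma integrable_mult_of_squares:
  fixes a b :: "'a \<Rightarrow> real"
  assumes [measurable]: "a \<in> borel_measurable M" "b \<in> borel_measurable M"
    and "integrable M (\<lambda>x. (a x)\<^sup>2)" "integrable M (\<lambda>x. (b x)\<^sup>2)"
  shows "integrable M (\<lambda>x. a x * b x)"
proof (rule Bochner_Integration.integrable_bound)
  show "integrable M (\<lambda>x. (a x)\<^sup>2 + (b x)\<^sup>2)"
    using assms by simp
  show "AE x in M. norm (a x * b x) \<le> norm ((a x)\<^sup>2 + (b x)\<^sup>2)"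
  proof (rule AE_I2)
    fix x
    have "2 * \<bar>a x * b x\<bar> \<le> (a x)\<^sup>2 + (b x)\<^sup>2"
      using zero_le_power2[of "\<bar>a x\<bar> - \<bar>b x\<bar>"] by (simp add: power2_diff abs_mult)
    then show "norm (a x * b x) \<le> norm ((a x)\<^sup>2 + (b x)\<^sup>2)"
      by simp
  qed
qed measurable

text \<open>
  Passing from amplitudes to normalised amplitudes costs only the norm of one of the two: in the
  Hilbert space \<open>L\<^sup>2\<close> the squared distance from \<open>a\<close> to the ray spanned by \<open>b\<close> is
  \<open>\<parallel>a\<parallel>\<^sup>2 (1 - t\<^sup>2)\<close>, where \<open>t\<close> is the cosine of the angle between \<open>a\<close> and \<open>b\<close>, while the squared
  Hellinger distance is \<open>1 - t\<close>. Nonnegative amplitudes have \<open>0 \<le> t \<le> 1\<close>, hence \<open>1 - t \<le> 1 - t\<^sup>2\<close>.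
  The factor depends on \<open>a\<close> alone, so the bound is uniform over approximate posteriors with
  arbitrarily small evidence.
\<close>
lemma (in sigma_finite_measure) hellinger_normalised_amplitudes:
  fixes a b :: "'a \<Rightarrow> real"
  assumes [measurable]: "a \<in> borel_measurable M" "b \<in> borel_measurable M"
    and nonneg: "\<And>x. 0 \<le> a x" "\<And>x. 0 \<le> b x"
    and int: "integrable M (\<lambda>x. (a x)\<^sup>2)" "integrable M (\<lambda>x. (b x)\<^sup>2)"
    and pos: "0 < (\<integral>x. (a x)\<^sup>2 \<partial>M)" "0 < (\<integral>x. (b x)\<^sup>2 \<partial>M)"
  shows "(hellinger M (density M (\<lambda>x. ennreal ((a x)\<^sup>2) / (\<integral>\<^sup>+x. ennreal ((a x)\<^sup>2) \<partial>M)))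
      (density M (\<lambda>x. ennreal ((b x)\<^sup>2) / (\<integral>\<^sup>+x. ennreal ((b x)\<^sup>2) \<partial>M))))\<^sup>2 * (\<integral>x. (a x)\<^sup>2 \<partial>M)
    \<le> (\<integral>x. (a x - b x)\<^sup>2 \<partial>M)"
proof -
  define A B c where "A = (\<integral>x. (a x)\<^sup>2 \<partial>M)" and "B = (\<integral>x. (b x)\<^sup>2 \<partial>M)" and "c = (\<integral>x. a x * b x \<partial>M)"
  have A: "0 < A" and B: "0 < B" using pos by (auto simp: A_def B_def)
  have c: "0 \<le> c" unfolding c_def using nonneg by (intro Bochner_Integration.integral_nonneg) auto
  note int_ab = integrable_mult_of_squares[OF assms(1,2) int]
  \<comment> \<open>The Radon--Nikodym derivative is chosen only up to null sets; here it is identified.\<close>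
  have root_density: "AE x in M. sqrt (enn2real (RN_deriv M
      (density M (\<lambda>x. ennreal ((h x)\<^sup>2) / (\<integral>\<^sup>+x. ennreal ((h x)\<^sup>2) \<partial>M))) x))
      = h x / sqrt (\<integral>x. (h x)\<^sup>2 \<partial>M)"
    if [measurable]: "h \<in> borel_measurable M" and h: "\<And>x. 0 \<le> h x" "integrable M (\<lambda>x. (h x)\<^sup>2)"
      "0 < (\<integral>x. (h x)\<^sup>2 \<partial>M)" for h :: "'a \<Rightarrow> real"
  proof -
    have "(\<integral>\<^sup>+x. ennreal ((h x)\<^sup>2) \<partial>M) = ennreal (\<integral>x. (h x)\<^sup>2 \<partial>M)"
      using h(2) by (intro nn_integral_eq_integral) auto
    then have eq: "ennreal ((h x)\<^sup>2) / (\<integral>\<^sup>+x. ennreal ((h x)\<^sup>2) \<partial>M) = ennreal ((h x)\<^sup>2 / (\<integral>x. (h x)\<^sup>2 \<partial>M))" for x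
      using h(3) by (simp add: divide_ennreal)
    have "AE x in M. ennreal ((h x)\<^sup>2 / (\<integral>x. (h x)\<^sup>2 \<partial>M)) =
        RN_deriv M (density M (\<lambda>x. ennreal ((h x)\<^sup>2) / (\<integral>\<^sup>+x. ennreal ((h x)\<^sup>2) \<partial>M))) x"
      unfolding eq by (intro RN_deriv_unique) auto
    then show ?thesis
    proof eventually_elim
      case (elim x)
      then show ?case
        using h(1)[of x] h(3) by (simp add: real_sqrt_divide flip: elim)
    qed
  qed
  have "(\<integral>x. (\<bar>sqrt (enn2real (RN_deriv M (density M (\<lambda>x. ennreal ((a x)\<^sup>2) / (\<integral>\<^sup>+x. ennreal ((a x)\<^sup>2) \<partial>M))) x))
      - sqrt (enn2real (RN_deriv M (density M (\<lambda>x. ennreal ((b x)\<^sup>2) / (\<integral>\<^sup>+x. ennreal ((b x)\<^sup>2) \<partial>M))) x))\<bar>)\<^sup>2 \<partial>M)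
    = (\<integral>x. (a x / sqrt A - b x / sqrt B)\<^sup>2 \<partial>M)"
    unfolding A_def B_def
    using root_density[OF assms(1) nonneg(1) int(1) pos(1)] root_density[OF assms(2) nonneg(2) int(2) pos(2)]
    by (intro integral_cong_AE) auto
  also have "\<dots> = (\<integral>x. (a x)\<^sup>2 / A + (b x)\<^sup>2 / B - 2 * (a x * b x) / (sqrt A * sqrt B) \<partial>M)"
    using A B by (simp add: power2_diff power_divide mult.assoc)
  also have "\<dots> = A / A + B / B - 2 * c / (sqrt A * sqrt B)"
    using int int_ab by (simp add: A_def B_def c_def)
  finally have hell: "(hellinger M (density M (\<lambda>x. ennreal ((a x)\<^sup>2) / (\<integral>\<^sup>+x. ennreal ((a x)\<^sup>2) \<partial>M)))
      (density M (\<lambda>x. ennreal ((b x)\<^sup>2) / (\<integral>\<^sup>+x. ennreal ((b x)\<^sup>2) \<partial>M))))\<^sup>2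
      = 1 - c / (sqrt A * sqrt B)"
    using A B unfolding hellinger_def
    by (subst real_sqrt_pow2) (auto simp: field_simps intro!: Bochner_Integration.integral_nonneg)
  have rhs: "(\<integral>x. (a x - b x)\<^sup>2 \<partial>M) = A + B - 2 * c"
    using int int_ab by (simp add: power2_diff mult.assoc A_def B_def c_def)
  \<comment> \<open>Dividing by A, with s = sqrt(B/A), the claim is 1 - t \<le> 1 + s^2 - 2ts, whose right-hand side is
    (s - t)^2 + (1 - t)(1 + t). For t > 1 the left-hand side is negative.\<close>
  define t where "t = c / (sqrt A * sqrt B)"
  have c_eq: "c = t * sqrt A * sqrt B" and t: "0 \<le> t"
    using A B c by (auto simp: t_def)
  have "(1 - t) * A \<le> A + B - 2 * c"
  proof (cases "t \<le> 1")
    case True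
    have "0 \<le> (sqrt B - t * sqrt A)\<^sup>2 + t * (1 - t) * A"
      using t True A by simp
    also have "(sqrt B - t * sqrt A)\<^sup>2 = B - 2 * c + t\<^sup>2 * A"
      using A B by (simp add: power2_diff power_mult_distrib c_eq mult_ac)
    finally show ?thesis by (simp add: algebra_simps power2_eq_square)
  next
    case False
    have "0 \<le> (\<integral>x. (a x - b x)\<^sup>2 \<partial>M)" by simp
    moreover have "(1 - t) * A \<le> 0" using False A by (simp add: mult_nonpos_nonneg)
    ultimately show ?thesis using rhs by linarith
  qed
  then show ?thesis by (simp add: hell rhs t_def A_def[symmetric])
qed

lemma (in prob_space) expectation_pos:
  fixes X :: "'a \<Rightarrow> real"
  assumes int: "integrable M X" and pos: "\<And>x. x \<in> space M \<Longrightarrow> 0 < X x"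
  shows "0 < expectation X"
proof -
  have "expectation X \<noteq> 0"
  proof
    assume "expectation X = 0"
    then have "AE x in M. X x = 0"
      using int pos by (subst (asm) integral_nonneg_eq_0_iff_AE) (auto simp: less_imp_le)
    moreover have "AE x in M. X x \<noteq> 0"
      using pos by (intro AE_I2) force
    ultimately have "AE x in M. False" by eventually_elim simp
    then show False by simp
  qed
  moreover have "0 \<le> expectation X"
    using pos by (intro integral_nonneg_AE) (auto simp: less_imp_le)
  ultimately show ?thesis by simp
qed

lemma (in prob_space) integrable_power2_bounded:
  fixes X :: "'a \<Rightarrow> real"
  assumes [measurable]: "X \<in> borel_measurable M" and "\<And>x. 0 \<le> X x" "\<And>x. X x \<le> 1"
  shows "integrable M (\<lambda>x. (X x)\<^sup>2)"
  using assms by (intro integrable_const_bound[where B = 1]) (auto simp: abs_square_le_1)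

text \<open>
  The form in which the estimate is applied: amplitudes with values in the unit interval are square
  integrable, and strict positivity gives a positive normalising constant.
\<close>
lemma (in prob_space) hellinger_le_amplitude_distance:
  fixes a b :: "'a \<Rightarrow> real"
  assumes [measurable]: "a \<in> borel_measurable M" "b \<in> borel_measurable M"
    and a: "\<And>x. x \<in> space M \<Longrightarrow> 0 < a x" "\<And>x. 0 \<le> a x" "\<And>x. a x \<le> 1"
    and b: "\<And>x. x \<in> space M \<Longrightarrow> 0 < b x" "\<And>x. 0 \<le> b x" "\<And>x. b x \<le> 1"
  shows "ennreal ((hellinger M (density M (\<lambda>x. ennreal ((a x)\<^sup>2) / (\<integral>\<^sup>+x. ennreal ((a x)\<^sup>2) \<partial>M)))
      (density M (\<lambda>x. ennreal ((b x)\<^sup>2) / (\<integral>\<^sup>+x. ennreal ((b x)\<^sup>2) \<partial>M))))\<^sup>2)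
    \<le> ennreal (1 / (\<integral>x. (a x)\<^sup>2 \<partial>M)) * (\<integral>\<^sup>+x. ennreal ((a x - b x)\<^sup>2) \<partial>M)"
proof -
  have int: "integrable M (\<lambda>x. (a x)\<^sup>2)" "integrable M (\<lambda>x. (b x)\<^sup>2)"
    using a b by (auto intro!: integrable_power2_bounded)
  have pos: "0 < (\<integral>x. (a x)\<^sup>2 \<partial>M)" "0 < (\<integral>x. (b x)\<^sup>2 \<partial>M)"
    using a b int by (auto intro!: expectation_pos zero_less_power)
  have diff: "integrable M (\<lambda>x. (a x - b x)\<^sup>2)"
    using int integrable_mult_of_squares[OF assms(1,2) int] by (simp add: power2_diff mult.assoc)
  note hellinger_normalised_amplitudes[OF assms(1,2) a(2) b(2) int pos]
  then have "(hellinger M (density M (\<lambda>x. ennreal ((a x)\<^sup>2) / (\<integral>\<^sup>+x. ennreal ((a x)\<^sup>2) \<partial>M)))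
      (density M (\<lambda>x. ennreal ((b x)\<^sup>2) / (\<integral>\<^sup>+x. ennreal ((b x)\<^sup>2) \<partial>M))))\<^sup>2
    \<le> 1 / (\<integral>x. (a x)\<^sup>2 \<partial>M) * (\<integral>x. (a x - b x)\<^sup>2 \<partial>M)"
    using pos by (simp add: field_simps)
  then show ?thesis
    using pos diff
    by (subst nn_integral_eq_integral) (auto simp flip: ennreal_mult intro!: ennreal_leI)
qed

text \<open>
  The reverse triangle inequality in \<open>L\<^sup>2\<close> of the probability space, for \<open>X\<close> and the constant \<open>a\<close>.
  With \<open>X\<close> a random amplitude it bounds the error of the root of the averaged likelihood by the
  mean square error of the amplitudes.
\<close>
lemma (in prob_space) root_second_moment_diff_le:
  fixes X :: "'a \<Rightarrow> real" and a :: real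
  assumes [measurable]: "X \<in> borel_measurable M" and int: "integrable M (\<lambda>x. (X x)\<^sup>2)" and a: "0 \<le> a"
  shows "(a - sqrt (expectation (\<lambda>x. (X x)\<^sup>2)))\<^sup>2 \<le> expectation (\<lambda>x. (a - X x)\<^sup>2)"
proof -
  have X: "integrable M X"
    by (rule square_integrable_imp_integrable[OF _ int]) measurable
  have "expectation X \<le> sqrt (expectation (\<lambda>x. (X x)\<^sup>2))"
    using variance_positive[of X] variance_eq[OF X int] by (intro real_le_rsqrt) simp
  then have "a * expectation X \<le> a * sqrt (expectation (\<lambda>x. (X x)\<^sup>2))"
    using a by (rule mult_left_mono)
  moreover have "expectation (\<lambda>x. (a - X x)\<^sup>2) = a\<^sup>2 + expectation (\<lambda>x. (X x)\<^sup>2) - 2 * a * expectation X"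
    using X int by (simp add: power2_diff prob_space)
  ultimately show ?thesis
    by (simp add: power2_diff)
qed

section \<open>Power means and the forward error\<close>

lemma measurable_enn_powr [measurable]: "(\<lambda>x. enn_powr x a) \<in> borel_measurable borel"
  unfolding enn_powr_def by measurable

lemma enn_powr_mono:
  assumes "x \<le> y" "0 \<le> a"
  shows "enn_powr x a \<le> enn_powr y a"
  using assms
  by (auto simp: enn_powr_def top_unique less_top intro!: ennreal_leI powr_mono2 enn2real_mono)

lemma enn_powr_half_scale:
  assumes "0 < C"
  shows "enn_powr (ennreal (C\<^sup>2) * x) (1 / 2) = ennreal C * enn_powr x (1 / 2)"
proof (cases "x = \<top>")
  case True
  then show ?thesis using assms by (simp add: enn_powr_def ennreal_mult_top)
next
  case False
  then obtain v where "x = ennreal v" "0 \<le> v" by (cases x) auto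
  then show ?thesis
    using assms by (simp add: enn_powr_def powr_half_sqrt real_sqrt_mult flip: ennreal_mult)
qed

lemma enn_powr_half_power2:
  assumes "0 \<le> h"
  shows "enn_powr (ennreal (h\<^sup>2)) (1 / 2) = ennreal h"
  using assms by (simp add: enn_powr_def powr_half_sqrt)

text \<open>
  Jensen's inequality on the extended half-line. By Young's inequality
  \<open>x \<le> c ((x / c)\<^sup>r / r + 1 - 1 / r)\<close> for every \<open>c > 0\<close>; integrating and optimising over \<open>c\<close> gives the
  bound.
\<close>
lemma (in prob_space) nn_integral_le_Lr_norm:
  assumes [measurable]: "g \<in> borel_measurable M" and r: "1 \<le> r"
  shows "(\<integral>\<^sup>+x. g x \<partial>M) \<le> Lr_norm M r g"
proof (cases "(\<integral>\<^sup>+x. enn_powr (g x) r \<partial>M) = \<top>")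
  case True
  then show ?thesis by (simp add: Lr_norm_def enn_powr_def)
next
  case False
  have [measurable]: "(\<lambda>x. enn_powr (g x) r) \<in> borel_measurable M"
    unfolding enn_powr_def by measurable
  define I where "I = enn2real (\<integral>\<^sup>+x. enn_powr (g x) r \<partial>M)"
  have I: "(\<integral>\<^sup>+x. enn_powr (g x) r \<partial>M) = ennreal I" "0 \<le> I"
    using False by (simp_all add: I_def top.not_eq_extremum)
  have young: "x \<le> ennreal (c / (r * c powr r)) * enn_powr x r + ennreal (c * (1 - 1 / r))"
    if c: "0 < c" for x c
  proof (cases "x = \<top>")
    case True
    then show ?thesis using c r by (simp add: enn_powr_def ennreal_mult_top)
  next
    case False
    then obtain v where v: "x = ennreal v" "0 \<le> v" by (cases x) auto
    \<comment> \<open>Young's inequality needs a conjugate exponent, so the case r = 1 is separate.\<close>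
    have "v / c \<le> (v / c) powr r / r + (1 - 1 / r)"
    proof (cases "r = 1")
      case False
      then have "(v / c) * 1 \<le> (v / c) powr r / r + 1 powr (1 / (1 - 1 / r)) / (1 / (1 - 1 / r))"
        using r c v by (intro Youngs_inequality) (auto simp: field_simps)
      then show ?thesis by simp
    qed (use c v in auto)
    then have "c * (v / c) \<le> c * ((v / c) powr r / r + (1 - 1 / r))"
      using c by (intro mult_left_mono) auto
    moreover have "c * ((v / c) powr r / r + (1 - 1 / r)) = c / (r * c powr r) * v powr r + c * (1 - 1 / r)"
      using c v by (simp add: powr_divide distrib_left)
    ultimately have "v \<le> c / (r * c powr r) * v powr r + c * (1 - 1 / r)"
      using c by simp
    then show ?thesis
      using v c r by (auto simp: enn_powr_def simp flip: ennreal_mult ennreal_plus intro!: ennreal_leI)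
  qed
  have bound: "(\<integral>\<^sup>+x. g x \<partial>M) \<le> ennreal (c * (I / (r * c powr r) + (1 - 1 / r)))" if c: "0 < c" for c
  proof -
    have "(\<integral>\<^sup>+x. g x \<partial>M) \<le>
        (\<integral>\<^sup>+x. ennreal (c / (r * c powr r)) * enn_powr (g x) r + ennreal (c * (1 - 1 / r)) \<partial>M)"
      by (intro nn_integral_mono young c)
    also have "\<dots> = ennreal (c / (r * c powr r)) * ennreal I + ennreal (c * (1 - 1 / r))"
      by (simp add: nn_integral_add nn_integral_cmult emeasure_space_1 I)
    also have "\<dots> = ennreal (c * (I / (r * c powr r) + (1 - 1 / r)))"
    proof -
      have "c * (I / (r * c powr r) + (1 - 1 / r)) = c / (r * c powr r) * I + c * (1 - 1 / r)"
        by (simp add: algebra_simps)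
      moreover have "0 \<le> c / (r * c powr r) * I" "0 \<le> c * (1 - 1 / r)"
        using c r I by auto
      ultimately show ?thesis
        using ennreal_mult''[of "c / (r * c powr r)" I] c r I by (simp add: mult_ac)
    qed
    finally show ?thesis .
  qed
  \<comment> \<open>The optimal c is the norm itself; if that vanishes, c tends to 0 instead.\<close>
  show ?thesis
  proof (cases "I = 0")
    case True
    have "(\<integral>\<^sup>+x. g x \<partial>M) \<le> ennreal e" if "0 < e" for e
    proof -
      have "e * (1 - 1 / r) \<le> e * 1" using that r by (intro mult_left_mono) auto
      then have "ennreal (e * (I / (r * e powr r) + (1 - 1 / r))) \<le> ennreal e"
        using True by (intro ennreal_leI) simp
      with bound[OF that] show ?thesis by (rule order_trans)
    qed
    then have "(\<integral>\<^sup>+x. g x \<partial>M) \<le> 0"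
      by - (rule ennreal_le_epsilon, simp)
    then show ?thesis by simp
  next
    case False
    then have "0 < I" using I by simp
    then have "(I powr (1 / r)) powr r = I" "0 < I powr (1 / r)"
      using r by (simp_all add: powr_powr)
    with bound[of "I powr (1 / r)"] \<open>0 < I\<close> have "(\<integral>\<^sup>+x. g x \<partial>M) \<le> ennreal (I powr (1 / r))"
      by simp
    then show ?thesis using I by (simp add: Lr_norm_def enn_powr_def)
  qed
qed

text \<open>
  Among exponents that are at least 1 the forward error is smallest for \<open>r = s = 1\<close>, where it is the
  root mean square error: Jensen's inequality applies first over the noise, then over the parameter.
\<close>
lemma mean_square_error_le_forward_error:
  fixes G :: "'u \<Rightarrow> 'y::{real_normed_vector, second_countable_topology}"
  assumes P: "prob_space P" and mu0: "prob_space mu0" and r: "1 \<le> r" and s: "1 \<le> s"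
    and [measurable]: "G \<in> borel_measurable mu0" "(\<lambda>(\<omega>, u). GN \<omega> u) \<in> borel_measurable (P \<Otimes>\<^sub>M mu0)"
  shows "enn_powr (\<integral>\<^sup>+u. \<integral>\<^sup>+\<omega>. ennreal ((norm (GN \<omega> u - G u))\<^sup>2) \<partial>P \<partial>mu0) (1 / 2)
    \<le> forward_error P mu0 G GN r s"
proof -
  interpret P: prob_space P by fact
  interpret mu0: prob_space mu0 by fact
  define h where "h u = enn_powr (\<integral>\<^sup>+ \<omega>. ennreal (norm (GN \<omega> u - G u) powr (2 * r)) \<partial>P) (1 / r)" for u
  have h [measurable]: "h \<in> borel_measurable mu0"
    unfolding h_def by measurable
  have "(\<integral>\<^sup>+\<omega>. ennreal ((norm (GN \<omega> u - G u))\<^sup>2) \<partial>P) \<le> h u" if "u \<in> space mu0" for u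
  proof -
    have [measurable]: "(\<lambda>\<omega>. GN \<omega> u) \<in> borel_measurable P"
      using measurable_compose[OF measurable_Pair2'[OF that] assms(6)] by simp
    have "(\<integral>\<^sup>+\<omega>. ennreal ((norm (GN \<omega> u - G u))\<^sup>2) \<partial>P)
        \<le> Lr_norm P r (\<lambda>\<omega>. ennreal ((norm (GN \<omega> u - G u))\<^sup>2))"
      using r by (intro P.nn_integral_le_Lr_norm) auto
    also have "\<dots> = h u"
    proof -
      have "(v\<^sup>2) powr r = v powr (2 * r)" if "0 \<le> v" for v :: real
        using that by (metis powr_numeral powr_powr)
      then show ?thesis
        by (simp add: Lr_norm_def h_def enn_powr_def)
    qed
    finally show ?thesis .
  qed
  then have "(\<integral>\<^sup>+u. \<integral>\<^sup>+\<omega>. ennreal ((norm (GN \<omega> u - G u))\<^sup>2) \<partial>P \<partial>mu0) \<le> (\<integral>\<^sup>+u. h u \<partial>mu0)"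
    by (rule nn_integral_mono)
  also have "\<dots> \<le> Lr_norm mu0 s h"
    using s by (intro mu0.nn_integral_le_Lr_norm) auto
  finally show ?thesis
    unfolding forward_error_def h_def by (intro enn_powr_mono) auto
qed

section \<open>Error bounds for jointly measurable forward models\<close>

text \<open>
  For a single realisation \<open>H\<close> of the random forward model the Lipschitz bound on the amplitudes is
  inserted pointwise into the Hellinger estimate.
\<close>
lemma sample_posterior_error:
  fixes \<Gamma> :: "real ^ 'n ^ 'n"
  assumes mu0: "prob_space mu0"
    and [measurable]: "G \<in> borel_measurable mu0" "H \<in> borel_measurable mu0"
    and L: "0 < L" "\<And>g h. \<bar>amplitude \<Gamma> y g - amplitude \<Gamma> y h\<bar> \<le> L * norm (h - g)"
  shows "ennreal ((hellinger mu0 (posterior mu0 (misfit \<Gamma> y G)) (posterior mu0 (misfit \<Gamma> y H)))\<^sup>2)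
    \<le> ennreal (L\<^sup>2 / (\<integral>u. exp (- misfit \<Gamma> y G u) \<partial>mu0)) * (\<integral>\<^sup>+u. ennreal ((norm (H u - G u))\<^sup>2) \<partial>mu0)"
proof -
  interpret prob_space mu0 by fact
  let ?a = "\<lambda>u. amplitude \<Gamma> y (G u)" and ?b = "\<lambda>u. amplitude \<Gamma> y (H u)"
  let ?Z = "\<integral>u. exp (- misfit \<Gamma> y G u) \<partial>mu0"
  have "ennreal ((hellinger mu0 (posterior mu0 (misfit \<Gamma> y G)) (posterior mu0 (misfit \<Gamma> y H)))\<^sup>2)
      \<le> ennreal (1 / ?Z) * (\<integral>\<^sup>+u. ennreal ((?a u - ?b u)\<^sup>2) \<partial>mu0)"
    unfolding posterior_eq_normalised_amplitude exp_misfit_eq_amplitude_squared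
    by (rule hellinger_le_amplitude_distance) (auto simp: amplitude_pos amplitude_le_1 less_imp_le)
  also have "(\<integral>\<^sup>+u. ennreal ((?a u - ?b u)\<^sup>2) \<partial>mu0)
      \<le> (\<integral>\<^sup>+u. ennreal (L\<^sup>2) * ennreal ((norm (H u - G u))\<^sup>2) \<partial>mu0)"
    using power_mono[OF L(2), of _ _ 2]
    by (intro nn_integral_mono) (auto simp: power_mult_distrib simp flip: ennreal_mult intro!: ennreal_leI)
  also have "\<dots> = ennreal (L\<^sup>2) * (\<integral>\<^sup>+u. ennreal ((norm (H u - G u))\<^sup>2) \<partial>mu0)"
    by (rule nn_integral_cmult) measurable
  also have "ennreal (1 / ?Z) * \<dots>
      = ennreal (L\<^sup>2 / ?Z) * (\<integral>\<^sup>+u. ennreal ((norm (H u - G u))\<^sup>2) \<partial>mu0)"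
    by (simp add: mult.assoc[symmetric] flip: ennreal_mult')
  finally show ?thesis by (simp add: mult_left_mono)
qed

text \<open>
  The amplitude of the marginal posterior is the root of the second moment of the random amplitudes.
  By Tonelli, the averaged evidence is its normalising constant.
\<close>
lemma marginal_posterior_error:
  fixes \<Gamma> :: "real ^ 'n ^ 'n"
  assumes mu0: "prob_space mu0" and P: "prob_space P"
    and [measurable]: "G \<in> borel_measurable mu0"
    and GN [measurable]: "(\<lambda>(\<omega>, u). GN \<omega> u) \<in> borel_measurable (P \<Otimes>\<^sub>M mu0)"
    and L: "0 < L" "\<And>g h. \<bar>amplitude \<Gamma> y g - amplitude \<Gamma> y h\<bar> \<le> L * norm (h - g)"
  shows "ennreal ((hellinger mu0 (posterior mu0 (misfit \<Gamma> y G))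
        (marginal_posterior P mu0 (\<lambda>\<omega>. misfit \<Gamma> y (GN \<omega>))))\<^sup>2)
    \<le> ennreal (L\<^sup>2 / (\<integral>u. exp (- misfit \<Gamma> y G u) \<partial>mu0))
      * (\<integral>\<^sup>+u. \<integral>\<^sup>+\<omega>. ennreal ((norm (GN \<omega> u - G u))\<^sup>2) \<partial>P \<partial>mu0)"
proof -
  interpret mu0: prob_space mu0 by fact
  interpret P: prob_space P by fact
  interpret pair_sigma_finite P mu0 ..
  let ?a = "\<lambda>u. amplitude \<Gamma> y (G u)" and ?X = "\<lambda>u \<omega>. amplitude \<Gamma> y (GN \<omega> u)"
  let ?Z = "\<integral>u. exp (- misfit \<Gamma> y G u) \<partial>mu0"
  \<comment> \<open>b is the amplitude of the marginal posterior. Outside the space of the prior the integrand may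
    fail to be measurable; the Bochner integral is then 0, which keeps 0 \<le> b \<le> 1 everywhere.\<close>
  define b where "b u = sqrt (\<integral>\<omega>. (?X u \<omega>)\<^sup>2 \<partial>P)" for u
  have X [measurable]: "?X u \<in> borel_measurable P" if "u \<in> space mu0" for u
    using measurable_compose[OF measurable_Pair2'[OF that] GN] by simp
  have X_int: "integrable P (\<lambda>\<omega>. (?X u \<omega>)\<^sup>2)" if "u \<in> space mu0" for u
    using X[OF that] by (rule P.integrable_power2_bounded) (auto simp: amplitude_pos amplitude_le_1 less_imp_le)
  have b_meas [measurable]: "b \<in> borel_measurable mu0"
    unfolding b_def by measurable
  have b_pos: "0 < b u" if "u \<in> space mu0" for u
    unfolding b_def
    by (intro real_sqrt_gt_zero P.expectation_pos X_int that zero_less_power amplitude_pos)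
  have b_le: "b u \<le> 1" for u
  proof (cases "integrable P (\<lambda>\<omega>. (?X u \<omega>)\<^sup>2)")
    case True
    then have "(\<integral>\<omega>. (?X u \<omega>)\<^sup>2 \<partial>P) \<le> (\<integral>\<omega>. 1 \<partial>P)"
      by (intro integral_mono) (auto simp: amplitude_pos amplitude_le_1 less_imp_le abs_square_le_1)
    then show ?thesis by (simp add: b_def P.prob_space)
  qed (simp add: b_def not_integrable_integral_eq)
  have b_sq: "ennreal ((b u)\<^sup>2) = (\<integral>\<^sup>+\<omega>. ennreal (exp (- misfit \<Gamma> y (GN \<omega>) u)) \<partial>P)" if "u \<in> space mu0" for u
    using X_int[OF that] by (simp add: b_def exp_misfit_eq_amplitude_squared nn_integral_eq_integral)
  have "(\<integral>\<^sup>+\<omega>. evidence mu0 (misfit \<Gamma> y (GN \<omega>)) \<partial>P)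
      = (\<integral>\<^sup>+u. \<integral>\<^sup>+\<omega>. ennreal (exp (- misfit \<Gamma> y (GN \<omega>) u)) \<partial>P \<partial>mu0)"
    unfolding evidence_def exp_misfit_eq_amplitude_squared by (rule Fubini'[symmetric]) measurable
  also have "\<dots> = (\<integral>\<^sup>+u. ennreal ((b u)\<^sup>2) \<partial>mu0)"
    by (intro nn_integral_cong) (simp add: b_sq)
  finally have marginal: "marginal_posterior P mu0 (\<lambda>\<omega>. misfit \<Gamma> y (GN \<omega>))
      = density mu0 (\<lambda>u. ennreal ((b u)\<^sup>2) / (\<integral>\<^sup>+u. ennreal ((b u)\<^sup>2) \<partial>mu0))"
    unfolding marginal_posterior_def exp_misfit_eq_amplitude_squared
    by (intro density_cong) (auto simp: b_sq exp_misfit_eq_amplitude_squared)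
  have diff: "ennreal ((?a u - b u)\<^sup>2) \<le> ennreal (L\<^sup>2) * (\<integral>\<^sup>+\<omega>. ennreal ((norm (GN \<omega> u - G u))\<^sup>2) \<partial>P)"
    if u: "u \<in> space mu0" for u
  proof -
    note [measurable] = X[OF u]
    have GN_u [measurable]: "(\<lambda>\<omega>. GN \<omega> u) \<in> borel_measurable P"
      using measurable_compose[OF measurable_Pair2'[OF u] GN] by simp
    have int: "integrable P (\<lambda>\<omega>. (?a u - ?X u \<omega>)\<^sup>2)"
      using X_int[OF u] P.square_integrable_imp_integrable[OF X[OF u] X_int[OF u]]
      by (simp add: power2_diff)
    have "ennreal ((?a u - b u)\<^sup>2) \<le> ennreal (\<integral>\<omega>. (?a u - ?X u \<omega>)\<^sup>2 \<partial>P)"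
      unfolding b_def using X_int[OF u]
      by (intro ennreal_leI P.root_second_moment_diff_le) (auto simp: amplitude_pos less_imp_le)
    also have "\<dots> = (\<integral>\<^sup>+\<omega>. ennreal ((?a u - ?X u \<omega>)\<^sup>2) \<partial>P)"
      using int by (simp add: nn_integral_eq_integral)
    also have "\<dots> \<le> (\<integral>\<^sup>+\<omega>. ennreal (L\<^sup>2) * ennreal ((norm (GN \<omega> u - G u))\<^sup>2) \<partial>P)"
      using power_mono[OF L(2), of _ _ 2]
      by (intro nn_integral_mono) (auto simp: power_mult_distrib simp flip: ennreal_mult intro!: ennreal_leI)
    also have "\<dots> = ennreal (L\<^sup>2) * (\<integral>\<^sup>+\<omega>. ennreal ((norm (GN \<omega> u - G u))\<^sup>2) \<partial>P)"
      by (rule nn_integral_cmult) measurable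
    finally show ?thesis .
  qed
  have "ennreal ((hellinger mu0 (posterior mu0 (misfit \<Gamma> y G))
        (marginal_posterior P mu0 (\<lambda>\<omega>. misfit \<Gamma> y (GN \<omega>))))\<^sup>2)
      \<le> ennreal (1 / ?Z) * (\<integral>\<^sup>+u. ennreal ((?a u - b u)\<^sup>2) \<partial>mu0)"
    unfolding marginal posterior_eq_normalised_amplitude exp_misfit_eq_amplitude_squared
    using b_pos b_le
    by (intro mu0.hellinger_le_amplitude_distance) (auto simp: amplitude_pos amplitude_le_1 less_imp_le b_def)
  also have "(\<integral>\<^sup>+u. ennreal ((?a u - b u)\<^sup>2) \<partial>mu0)
      \<le> (\<integral>\<^sup>+u. ennreal (L\<^sup>2) * (\<integral>\<^sup>+\<omega>. ennreal ((norm (GN \<omega> u - G u))\<^sup>2) \<partial>P) \<partial>mu0)"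
    using diff by (rule nn_integral_mono)
  also have "\<dots> = ennreal (L\<^sup>2) * (\<integral>\<^sup>+u. \<integral>\<^sup>+\<omega>. ennreal ((norm (GN \<omega> u - G u))\<^sup>2) \<partial>P \<partial>mu0)"
    by (rule nn_integral_cmult) measurable
  also have "ennreal (1 / ?Z) * \<dots> = ennreal (L\<^sup>2 / ?Z)
      * (\<integral>\<^sup>+u. \<integral>\<^sup>+\<omega>. ennreal ((norm (GN \<omega> u - G u))\<^sup>2) \<partial>P \<partial>mu0)"
    by (simp add: mult.assoc[symmetric] flip: ennreal_mult')
  finally show ?thesis by (simp add: mult_left_mono)
qed

text \<open>
  One constant serves both posteriors and every forward model and pair of exponents: it consists of
  the Lipschitz constant of the amplitude and the evidence of the exact posterior.
\<close>
lemma posterior_errors_le_forward_error: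
  fixes \<Gamma> :: "real ^ 'n ^ 'n" and P :: "'w measure"
  assumes mu0: "prob_space mu0" and P: "prob_space P"
    and G [measurable]: "G \<in> borel_measurable mu0"
  obtains C where "0 < C"
    "\<And>GN r s. \<lbrakk>(\<lambda>(\<omega>, u). GN \<omega> u) \<in> borel_measurable (P \<Otimes>\<^sub>M mu0); 1 \<le> r; 1 \<le> s\<rbrakk> \<Longrightarrow>
      ennreal (hellinger mu0 (posterior mu0 (misfit \<Gamma> y G))
          (marginal_posterior P mu0 (\<lambda>\<omega>. misfit \<Gamma> y (GN \<omega>))))
        \<le> ennreal C * forward_error P mu0 G GN r s"
    "\<And>GN r s. \<lbrakk>(\<lambda>(\<omega>, u). GN \<omega> u) \<in> borel_measurable (P \<Otimes>\<^sub>M mu0); 1 \<le> r; 1 \<le> s\<rbrakk> \<Longrightarrow>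
      enn_powr (\<integral>\<^sup>+ \<omega>. ennreal ((hellinger mu0 (posterior mu0 (misfit \<Gamma> y G))
          (posterior mu0 (misfit \<Gamma> y (GN \<omega>))))\<^sup>2) \<partial>P) (1 / 2)
        \<le> ennreal C * forward_error P mu0 G GN r s"
proof -
  interpret mu0: prob_space mu0 by fact
  interpret P: prob_space P by fact
  interpret pair_sigma_finite P mu0 ..
  obtain L where L: "0 < L" "\<And>g h. \<bar>amplitude \<Gamma> y g - amplitude \<Gamma> y h\<bar> \<le> L * norm (h - g)"
    using amplitude_lipschitz by blast
  let ?Z = "\<integral>u. exp (- misfit \<Gamma> y G u) \<partial>mu0"
  have "integrable mu0 (\<lambda>u. (amplitude \<Gamma> y (G u))\<^sup>2)"
    by (rule mu0.integrable_power2_bounded) (auto simp: amplitude_pos amplitude_le_1 less_imp_le)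
  then have Z: "0 < ?Z"
    by (intro mu0.expectation_pos exp_gt_zero) (simp add: exp_misfit_eq_amplitude_squared)
  define C where "C = L / sqrt ?Z"
  have C: "0 < C" and C_sq: "C\<^sup>2 = L\<^sup>2 / ?Z"
    using L Z by (auto simp: C_def power_divide)
  have error: "enn_powr x (1 / 2) \<le> ennreal C * forward_error P mu0 G GN r s"
    if GN: "(\<lambda>(\<omega>, u). GN \<omega> u) \<in> borel_measurable (P \<Otimes>\<^sub>M mu0)" and rs: "1 \<le> r" "1 \<le> s"
      and x: "x \<le> ennreal (C\<^sup>2) * (\<integral>\<^sup>+u. \<integral>\<^sup>+\<omega>. ennreal ((norm (GN \<omega> u - G u))\<^sup>2) \<partial>P \<partial>mu0)"
    for x GN r s
  proof -
    have "enn_powr x (1 / 2) \<le> ennreal C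
        * enn_powr (\<integral>\<^sup>+u. \<integral>\<^sup>+\<omega>. ennreal ((norm (GN \<omega> u - G u))\<^sup>2) \<partial>P \<partial>mu0) (1 / 2)"
      using enn_powr_mono[OF x, of "1 / 2"] by (simp add: enn_powr_half_scale C)
    also have "\<dots> \<le> ennreal C * forward_error P mu0 G GN r s"
      by (intro mult_left_mono mean_square_error_le_forward_error assms rs GN) auto
    finally show ?thesis .
  qed
  show ?thesis
  proof (rule that[OF C])
    fix GN :: "'w \<Rightarrow> 'a \<Rightarrow> real ^ 'n" and r s :: real
    assume GN [measurable]: "(\<lambda>(\<omega>, u). GN \<omega> u) \<in> borel_measurable (P \<Otimes>\<^sub>M mu0)" and rs: "1 \<le> r" "1 \<le> s"
    let ?h = "hellinger mu0 (posterior mu0 (misfit \<Gamma> y G)) (marginal_posterior P mu0 (\<lambda>\<omega>. misfit \<Gamma> y (GN \<omega>)))"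
    have "0 \<le> ?h" by (auto simp: hellinger_def intro!: Bochner_Integration.integral_nonneg)
    then have "ennreal ?h = enn_powr (ennreal (?h\<^sup>2)) (1 / 2)"
      by (simp add: enn_powr_half_power2)
    also have "\<dots> \<le> ennreal C * forward_error P mu0 G GN r s"
      by (intro error GN rs) (unfold C_sq, rule marginal_posterior_error[OF mu0 P G GN L])
    finally show "ennreal ?h \<le> ennreal C * forward_error P mu0 G GN r s" .
  next
    fix GN :: "'w \<Rightarrow> 'a \<Rightarrow> real ^ 'n" and r s :: real
    assume GN [measurable]: "(\<lambda>(\<omega>, u). GN \<omega> u) \<in> borel_measurable (P \<Otimes>\<^sub>M mu0)" and rs: "1 \<le> r" "1 \<le> s"
    have "(\<integral>\<^sup>+\<omega>. ennreal ((hellinger mu0 (posterior mu0 (misfit \<Gamma> y G))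
          (posterior mu0 (misfit \<Gamma> y (GN \<omega>))))\<^sup>2) \<partial>P)
        \<le> (\<integral>\<^sup>+\<omega>. ennreal (C\<^sup>2) * (\<integral>\<^sup>+u. ennreal ((norm (GN \<omega> u - G u))\<^sup>2) \<partial>mu0) \<partial>P)"
    proof (intro nn_integral_mono)
      fix \<omega> assume "\<omega> \<in> space P"
      then have "GN \<omega> \<in> borel_measurable mu0"
        using measurable_compose[OF measurable_Pair1' GN] by simp
      then show "ennreal ((hellinger mu0 (posterior mu0 (misfit \<Gamma> y G)) (posterior mu0 (misfit \<Gamma> y (GN \<omega>))))\<^sup>2)
          \<le> ennreal (C\<^sup>2) * (\<integral>\<^sup>+u. ennreal ((norm (GN \<omega> u - G u))\<^sup>2) \<partial>mu0)"
        unfolding C_sq by (rule sample_posterior_error[OF mu0 G _ L])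
    qed
    also have "\<dots> = ennreal (C\<^sup>2) * (\<integral>\<^sup>+\<omega>. \<integral>\<^sup>+u. ennreal ((norm (GN \<omega> u - G u))\<^sup>2) \<partial>mu0 \<partial>P)"
      by (rule nn_integral_cmult) measurable
    also have "(\<integral>\<^sup>+\<omega>. \<integral>\<^sup>+u. ennreal ((norm (GN \<omega> u - G u))\<^sup>2) \<partial>mu0 \<partial>P)
        = (\<integral>\<^sup>+u. \<integral>\<^sup>+\<omega>. ennreal ((norm (GN \<omega> u - G u))\<^sup>2) \<partial>P \<partial>mu0)"
      by (rule Fubini'[symmetric]) measurable
    finally show "enn_powr (\<integral>\<^sup>+ \<omega>. ennreal ((hellinger mu0 (posterior mu0 (misfit \<Gamma> y G))
          (posterior mu0 (misfit \<Gamma> y (GN \<omega>))))\<^sup>2) \<partial>P) (1 / 2) \<le> ennreal C * forward_error P mu0 G GN r s"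
      by (intro error GN rs)
  qed
qed

section \<open>Measurability of the random forward model\<close>

text \<open>
  Exchanging the integrals over noise and parameter needs joint measurability, which a function that is
  measurable in one variable and continuous in the other has: discretising the continuous
  variable gives jointly measurable functions that converge pointwise.
\<close>
lemma caratheodory_jointly_measurable:
  fixes f :: "'w \<Rightarrow> 'u::{metric_space, second_countable_topology} \<Rightarrow> 'y::metric_space"
  assumes meas: "\<And>u. u \<in> U \<Longrightarrow> (\<lambda>\<omega>. f \<omega> u) \<in> borel_measurable P"
    and cont: "\<And>\<omega>. \<omega> \<in> space P \<Longrightarrow> continuous_on U (f \<omega>)"
  shows "(\<lambda>(\<omega>, u). f \<omega> u) \<in> borel_measurable (P \<Otimes>\<^sub>M restrict_space borel U)"
proof (cases "U = {}")
  case True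
  then show ?thesis
    by (simp add: measurable_def space_pair_measure space_restrict_space)
next
  case False
  obtain D where D: "countable D" "D \<subseteq> U" "U \<subseteq> closure D"
    by (rule separable)
  with False have "D \<noteq> {}" by auto
  define d where "d = from_nat_into D"
  have d: "range d = D" using D(1) \<open>D \<noteq> {}\<close> by (simp add: d_def range_from_nat_into)
  \<comment> \<open>Each u is replaced by the first point of a dense sequence in U that lies within 1/(n+1) of it.
    This is a countable-valued function of u whose values stay in U, where f is measurable in its first argument.\<close>
  define k where "k n u = (LEAST i. dist u (d i) < inverse (real (Suc n)))" for n u
  have k: "dist u (d (k n u)) < inverse (real (Suc n))" if "u \<in> U" for u n
  proof -
    have "\<exists>v\<in>D. dist v u < inverse (real (Suc n))"
      using D(3) that by (auto simp: closure_approachable)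
    then have "\<exists>i. dist u (d i) < inverse (real (Suc n))"
      using d by (metis dist_commute imageE)
    then show ?thesis unfolding k_def by (rule LeastI_ex)
  qed
  let ?M = "P \<Otimes>\<^sub>M restrict_space borel U"
  have "(\<lambda>x. f (fst x) (snd x)) \<in> borel_measurable ?M"
  proof (rule borel_measurable_LIMSEQ_metric)
    fix n
    have "(\<lambda>u. k n u) \<in> measurable (restrict_space borel U) (count_space UNIV)"
      unfolding k_def by (intro measurable_Least measurable_restrict_space1) measurable
    then have "(\<lambda>x. k n (snd x)) \<in> measurable ?M (count_space UNIV)"
      by measurable
    moreover have "(\<lambda>x. f (fst x) (d i)) \<in> borel_measurable ?M" for i
    proof -
      have [measurable]: "(\<lambda>\<omega>. f \<omega> (d i)) \<in> borel_measurable P"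
        using meas d D(2) by auto
      show ?thesis by measurable
    qed
    ultimately show "(\<lambda>x. f (fst x) (d (k n (snd x)))) \<in> borel_measurable ?M"
      by (rule measurable_compose_countable[where f = "\<lambda>i x. f (fst x) (d i)" and g = "\<lambda>x. k n (snd x)", rotated])
  next
    fix x assume "x \<in> space ?M"
    then have x: "fst x \<in> space P" "snd x \<in> U"
      by (auto simp: space_pair_measure space_restrict_space)
    have "(\<lambda>n. d (k n (snd x))) \<longlonglongrightarrow> snd x"
    proof (rule metric_tendsto_imp_tendsto[OF LIMSEQ_inverse_real_of_nat])
      show "\<forall>\<^sub>F n in sequentially. dist (d (k n (snd x))) (snd x) \<le> dist (inverse (real (Suc n))) 0"
        using k[OF x(2)] by (intro always_eventually) (auto simp: dist_commute less_imp_le)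
    qed
    moreover have "d i \<in> U" for i using d D(2) by auto
    ultimately show "(\<lambda>n. f (fst x) (d (k n (snd x)))) \<longlonglongrightarrow> f (fst x) (snd x)"
      using cont[OF x(1)] x(2) by (auto simp: continuous_on_sequentially comp_def)
  qed
  then show ?thesis by (simp add: case_prod_beta)
qed

text \<open>
  Evaluation at a fixed time is 1-Lipschitz for the supremum distance.
\<close>
lemma continuous_on_path_eval:
  fixes w :: "'u::topological_space \<Rightarrow> real \<Rightarrow> 'y::metric_space"
  assumes w: "continuous_map (top_of_set U) (mtopology_of (path_space T)) w" and t: "t \<in> {0..T}"
  shows "continuous_on U (\<lambda>u. w u t)"
proof -
  have "continuous_map (mtopology_of (path_space T)) euclidean (\<lambda>v :: real \<Rightarrow> 'y. v t)"
  proof -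
    have "Lipschitz_continuous_map (path_space T) euclidean_metric (\<lambda>v :: real \<Rightarrow> 'y. v t)"
      unfolding Lipschitz_continuous_map_def
    proof (intro conjI exI[of _ 1] ballI)
      fix v w :: "real \<Rightarrow> 'y"
      assume "v \<in> mspace (path_space T)" "w \<in> mspace (path_space T)"
      then show "mdist euclidean_metric (v t) (w t) \<le> 1 * mdist (path_space T) v w"
        using t unfolding path_space_def by (simp only: mult_1) (rule mdist_cfunspace_imp_mdist_le, auto)
    qed auto
    then show ?thesis
      using Lipschitz_continuous_imp_continuous_map by fastforce
  qed
  from continuous_map_compose[OF w this] show ?thesis
    by (simp add: comp_def)
qed

lemma continuous_on_observe:
  fixes w :: "'u::topological_space \<Rightarrow> real \<Rightarrow> real ^ 'd"
  assumes "continuous_map (top_of_set U) (mtopology_of (path_space T)) w" "range tobs \<subseteq> {0..T}"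
  shows "continuous_on U (observe tobs \<circ> w)"
  using assms(2)
  by (auto simp: observe_def comp_def
      intro!: continuous_on_vec_lambda continuous_on_component continuous_on_path_eval[OF assms(1)])

lemma measurable_observe:
  fixes w :: "'w \<Rightarrow> real \<Rightarrow> real ^ 'd" and tobs :: "'j::finite \<Rightarrow> real"
  assumes "\<And>j. (\<lambda>\<omega>. w \<omega> (tobs j)) \<in> borel_measurable P"
  shows "(\<lambda>\<omega>. observe tobs (w \<omega>)) \<in> borel_measurable P"
proof (rule borel_measurable_euclidean_space[THEN iffD2], rule ballI)
  fix i :: "real ^ ('d \<times> 'j)" assume "i \<in> Basis"
  then obtain ij where i: "i = axis ij 1" by (auto simp: Basis_vec_def)
  have "(\<lambda>\<omega>. w \<omega> (tobs (snd ij)) \<bullet> axis (fst ij) 1) \<in> borel_measurable P"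
    using assms by measurable
  then show "(\<lambda>\<omega>. observe tobs (w \<omega>) \<bullet> i) \<in> borel_measurable P"
    by (simp add: i observe_def inner_axis)
qed

section \<open>Convergence of the approximate posteriors\<close>

text \<open>
  Both sides of the error bounds see the random forward model only up to null sets of the noise, so it
  may be modified there.
\<close>
lemma marginal_posterior_cong_AE:
  assumes "AE \<omega> in P. \<Phi> \<omega> = \<Phi>' \<omega>"
  shows "marginal_posterior P mu0 \<Phi> = marginal_posterior P mu0 \<Phi>'"
proof -
  have "(\<integral>\<^sup>+ \<omega>. ennreal (exp (- \<Phi> \<omega> u)) \<partial>P) = (\<integral>\<^sup>+ \<omega>. ennreal (exp (- \<Phi>' \<omega> u)) \<partial>P)" for u
    using assms by (intro nn_integral_cong_AE) auto
  moreover have "(\<integral>\<^sup>+ \<omega>. evidence mu0 (\<Phi> \<omega>) \<partial>P) = (\<integral>\<^sup>+ \<omega>. evidence mu0 (\<Phi>' \<omega>) \<partial>P)"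
    using assms by (intro nn_integral_cong_AE) auto
  ultimately show ?thesis by (simp add: marginal_posterior_def)
qed

lemma forward_error_cong_AE:
  assumes "AE \<omega> in P. H \<omega> = H' \<omega>"
  shows "forward_error P mu0 G H r s = forward_error P mu0 G H' r s"
proof -
  have "(\<integral>\<^sup>+ \<omega>. ennreal (norm (H \<omega> u - G u) powr (2 * r)) \<partial>P)
      = (\<integral>\<^sup>+ \<omega>. ennreal (norm (H' \<omega> u - G u) powr (2 * r)) \<partial>P)" for u
    using assms by (intro nn_integral_cong_AE) auto
  then show ?thesis by (simp add: forward_error_def)
qed

theorem theorem5p6:
  fixes T :: real
    and U :: "(real ^ 'm) set"
    and f :: "real ^ 'd \<Rightarrow> real ^ 'm \<Rightarrow> real ^ 'd"
    and z0 :: "real ^ 'm \<Rightarrow> real ^ 'd"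
    and z :: "real ^ 'm \<Rightarrow> real \<Rightarrow> real ^ 'd"
    and F :: "real ^ 'm \<Rightarrow> real \<Rightarrow> real ^ 'd \<Rightarrow> real ^ 'd"
    and \<Psi> :: "real ^ 'm \<Rightarrow> real \<Rightarrow> real ^ 'd \<Rightarrow> real ^ 'd"
    and P :: "'w measure"
    and \<xi> :: "nat \<Rightarrow> nat \<Rightarrow> 'w \<Rightarrow> real \<Rightarrow> real ^ 'd"
    and Zini :: "real ^ 'm \<Rightarrow> real ^ 'd"
    and Z :: "nat \<Rightarrow> 'w \<Rightarrow> real ^ 'm \<Rightarrow> real \<Rightarrow> real ^ 'd"
    and S :: "real ^ 'm \<Rightarrow> real \<Rightarrow> real ^ 'd"
    and SN :: "nat \<Rightarrow> 'w \<Rightarrow> real ^ 'm \<Rightarrow> real \<Rightarrow> real ^ 'd"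
    and tobs :: "'j::{finite, linorder} \<Rightarrow> real"
    and G :: "real ^ 'm \<Rightarrow> real ^ ('d \<times> 'j)"
    and GN :: "nat \<Rightarrow> 'w \<Rightarrow> real ^ 'm \<Rightarrow> real ^ ('d \<times> 'j)"
    and y :: "real ^ ('d \<times> 'j)"
    and \<Gamma> :: "real ^ ('d \<times> 'j) ^ ('d \<times> 'j)"
    and mu0 :: "(real ^ 'm) measure"
    and taus CF CPsi q Cxi p :: "real ^ 'm \<Rightarrow> real"
    and rho :: real
  assumes T_pos: "0 < T"
    and U_compact: "compact U"
    and prior: "prob_space mu0" "sets mu0 = sets (restrict_space borel U)"
    and ode: "\<forall>u\<in>U. z u 0 = z0 u \<and>
      (\<forall>t\<in>{0..T}. (z u has_vector_derivative f (z u t) u) (at t within {0..T}))"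
    and flow: "\<forall>u\<in>U. \<forall>a. \<forall>\<tau>\<ge>0. ((\<lambda>t. f (F u t a) u) has_integral (F u \<tau> a - a)) {0..\<tau>}"
    and noise_space: "prob_space P"
    and noise_process: "\<forall>N>0. \<forall>k<N. \<forall>t\<in>{0..T / real N}. (\<lambda>\<omega>. \<xi> N k \<omega> t) \<in> borel_measurable P"
    and noise_paths: "\<forall>N>0. \<forall>k<N. AE \<omega> in P. continuous_on {0..T / real N} (\<xi> N k \<omega>)"
    and Z_eq: "\<forall>N \<omega> u. Z N \<omega> u = randomised_path T N (\<Psi> u) (\<lambda>k. \<xi> N k \<omega>) (Zini u)"
    and S_eq: "S = solution_op T z"
    and SN_eq: "\<forall>N \<omega>. SN N \<omega> = solution_op T (Z N \<omega>)"
    and obs_times: "strict_mono tobs" "range tobs \<subseteq> {0..T}"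
    and G_eq: "G = observe tobs \<circ> S"
    and GN_eq: "\<forall>N \<omega>. GN N \<omega> = observe tobs \<circ> SN N \<omega>"
    and Gamma_spd: "sym_posdef \<Gamma>"
    and S_cont: "continuous_map (top_of_set U) (mtopology_of (path_space T)) S"
    and SN_random: "\<forall>N. admissible T U taus N \<longrightarrow>
      (\<forall>u\<in>U. \<forall>t\<in>{0..T}. (\<lambda>\<omega>. SN N \<omega> u t) \<in> borel_measurable P)"
    and SN_cont: "\<forall>N. admissible T U taus N \<longrightarrow>
      (AE \<omega> in P. continuous_map (top_of_set U) (mtopology_of (path_space T)) (SN N \<omega>))"
    and rho: "2 < rho"
    and initial_error: "\<forall>N>0. \<forall>\<omega>\<in>space P. \<forall>u\<in>U. z u 0 - Z N \<omega> u 0 = 0"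
    and A1: "\<forall>u\<in>U. 0 < taus u \<and> taus u \<le> 1 \<and> 1 \<le> CF u \<and>
      (\<forall>\<tau>. 0 < \<tau> \<and> \<tau> < taus u \<longrightarrow>
        (\<forall>a b. norm (F u \<tau> a - F u \<tau> b) \<le> (1 + CF u * \<tau>) * norm (a - b)))"
    and A2: "\<forall>u\<in>U. 1 \<le> CPsi u \<and>
      (\<forall>\<tau>. 0 < \<tau> \<and> \<tau> < taus u \<longrightarrow>
        (\<forall>v. norm (\<Psi> u \<tau> v - F u \<tau> v) \<le> CPsi u * \<tau> powr (q u + 1)))"
    and A3: "\<forall>u\<in>U. 1 \<le> p u \<and> 1 \<le> Cxi u \<and>
      (\<forall>N. admissible T U taus N \<longrightarrow> (\<forall>r\<ge>1. \<forall>k<N.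
        (\<integral>\<^sup>+ \<omega>. (SUP t\<in>{0<..T / real N}. ennreal (norm (\<xi> N k \<omega> t) powr r)) \<partial>P)
          \<le> ennreal ((Cxi u * (T / real N) powr (p u + 1 / 2)) powr r)))"
    and param_cont: "continuous_on U taus" "continuous_on U CF" "continuous_on U CPsi"
      "continuous_on U q" "continuous_on U Cxi" "continuous_on U p"
  shows "(\<exists>C>0. \<forall>N. admissible T U taus N \<longrightarrow>
      ennreal (hellinger mu0 (posterior mu0 (misfit \<Gamma> y G))
          (marginal_posterior P mu0 (\<lambda>\<omega>. misfit \<Gamma> y (GN N \<omega>))))
        \<le> ennreal C * forward_error P mu0 G (GN N) 1 (2 * rho / (rho - 1)))
    \<and> (\<exists>D>0. \<forall>N. admissible T U taus N \<longrightarrow>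
      enn_powr (\<integral>\<^sup>+ \<omega>. ennreal ((hellinger mu0 (posterior mu0 (misfit \<Gamma> y G))
          (posterior mu0 (misfit \<Gamma> y (GN N \<omega>))))\<^sup>2) \<partial>P) (1 / 2)
        \<le> ennreal D * forward_error P mu0 G (GN N) (2 * rho / (rho - 2)) 2)"
proof -
  interpret mu0: prob_space mu0 by (rule prior(1))
  have measurable_mu0: "borel_measurable mu0 = borel_measurable (restrict_space borel U)"
    using prior(2) by (intro measurable_cong_sets) auto
  have G: "G \<in> borel_measurable mu0"
    unfolding measurable_mu0 G_eq
    by (intro borel_measurable_continuous_on_restrict continuous_on_observe[OF S_cont obs_times(2)])
  obtain C where C: "0 < C"
    and marginal: "\<And>H r s. \<lbrakk>(\<lambda>(\<omega>, u). H \<omega> u) \<in> borel_measurable (P \<Otimes>\<^sub>M mu0); 1 \<le> r; 1 \<le> s\<rbrakk> \<Longrightarrow>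
      ennreal (hellinger mu0 (posterior mu0 (misfit \<Gamma> y G))
          (marginal_posterior P mu0 (\<lambda>\<omega>. misfit \<Gamma> y (H \<omega>))))
        \<le> ennreal C * forward_error P mu0 G H r s"
    and sample: "\<And>H r s. \<lbrakk>(\<lambda>(\<omega>, u). H \<omega> u) \<in> borel_measurable (P \<Otimes>\<^sub>M mu0); 1 \<le> r; 1 \<le> s\<rbrakk> \<Longrightarrow>
      enn_powr (\<integral>\<^sup>+ \<omega>. ennreal ((hellinger mu0 (posterior mu0 (misfit \<Gamma> y G))
          (posterior mu0 (misfit \<Gamma> y (H \<omega>))))\<^sup>2) \<partial>P) (1 / 2)
        \<le> ennreal C * forward_error P mu0 G H r s"
    using posterior_errors_le_forward_error[OF prior(1) noise_space G, of \<Gamma> y] by blast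
  have version: "\<exists>H. (\<lambda>(\<omega>, u). H \<omega> u) \<in> borel_measurable (P \<Otimes>\<^sub>M mu0) \<and> (AE \<omega> in P. GN N \<omega> = H \<omega>)"
    if N: "admissible T U taus N" for N
  proof -
    obtain E where E: "{\<omega> \<in> space P. \<not> continuous_map (top_of_set U) (mtopology_of (path_space T)) (SN N \<omega>)} \<subseteq> E"
      "emeasure P E = 0" "E \<in> sets P"
      by (rule AE_E[OF SN_cont[rule_format, OF N]])
    \<comment> \<open>Cutting off the null set where continuity fails yields a random forward model that is
      continuous for every outcome.\<close>
    define H where "H \<omega> u = (if \<omega> \<in> E then 0 else GN N \<omega> u)" for \<omega> u
    have "(\<lambda>\<omega>. H \<omega> u) \<in> borel_measurable P" if u: "u \<in> U" for u
    proof -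
      have "(\<lambda>\<omega>. GN N \<omega> u) \<in> borel_measurable P"
        unfolding GN_eq[rule_format] comp_def
        by (intro measurable_observe SN_random[rule_format, OF N u] subsetD[OF obs_times(2)] rangeI)
      then show ?thesis
        unfolding H_def using E(3) by measurable
    qed
    moreover have "continuous_on U (H \<omega>)" if "\<omega> \<in> space P" for \<omega>
    proof (cases "\<omega> \<in> E")
      case False
      then have "continuous_map (top_of_set U) (mtopology_of (path_space T)) (SN N \<omega>)"
        using E(1) that by auto
      from continuous_on_observe[OF this obs_times(2)] show ?thesis
        using False by (simp add: H_def[abs_def] GN_eq)
    qed (simp add: H_def[abs_def])
    ultimately have "(\<lambda>(\<omega>, u). H \<omega> u) \<in> borel_measurable (P \<Otimes>\<^sub>M restrict_space borel U)"
      by (rule caratheodory_jointly_measurable)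
    moreover have "borel_measurable (P \<Otimes>\<^sub>M restrict_space borel U) = borel_measurable (P \<Otimes>\<^sub>M mu0)"
      using prior(2) by (intro measurable_cong_sets sets_pair_measure_cong) auto
    moreover have "AE \<omega> in P. GN N \<omega> = H \<omega>"
      using E(2,3) by (intro AE_I'[of E]) (auto simp: H_def fun_eq_iff null_sets_def)
    ultimately show ?thesis by auto
  qed
  have exponents: "1 \<le> 2 * rho / (rho - 1)" "1 \<le> 2 * rho / (rho - 2)"
    using rho by (auto simp: field_simps)
  have "ennreal (hellinger mu0 (posterior mu0 (misfit \<Gamma> y G))
          (marginal_posterior P mu0 (\<lambda>\<omega>. misfit \<Gamma> y (GN N \<omega>))))
        \<le> ennreal C * forward_error P mu0 G (GN N) 1 (2 * rho / (rho - 1))"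
    if N: "admissible T U taus N" for N
  proof -
    obtain H where H: "(\<lambda>(\<omega>, u). H \<omega> u) \<in> borel_measurable (P \<Otimes>\<^sub>M mu0)" "AE \<omega> in P. GN N \<omega> = H \<omega>"
      using version[OF N] by blast
    have "marginal_posterior P mu0 (\<lambda>\<omega>. misfit \<Gamma> y (GN N \<omega>)) = marginal_posterior P mu0 (\<lambda>\<omega>. misfit \<Gamma> y (H \<omega>))"
      using H(2) by (intro marginal_posterior_cong_AE) auto
    then show ?thesis
      using marginal[OF H(1)] exponents forward_error_cong_AE[OF H(2)] by simp
  qed
  moreover have "enn_powr (\<integral>\<^sup>+ \<omega>. ennreal ((hellinger mu0 (posterior mu0 (misfit \<Gamma> y G))
          (posterior mu0 (misfit \<Gamma> y (GN N \<omega>))))\<^sup>2) \<partial>P) (1 / 2)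
        \<le> ennreal C * forward_error P mu0 G (GN N) (2 * rho / (rho - 2)) 2"
    if N: "admissible T U taus N" for N
  proof -
    obtain H where H: "(\<lambda>(\<omega>, u). H \<omega> u) \<in> borel_measurable (P \<Otimes>\<^sub>M mu0)" "AE \<omega> in P. GN N \<omega> = H \<omega>"
      using version[OF N] by blast
    have "(\<integral>\<^sup>+ \<omega>. ennreal ((hellinger mu0 (posterior mu0 (misfit \<Gamma> y G)) (posterior mu0 (misfit \<Gamma> y (GN N \<omega>))))\<^sup>2) \<partial>P)
        = (\<integral>\<^sup>+ \<omega>. ennreal ((hellinger mu0 (posterior mu0 (misfit \<Gamma> y G)) (posterior mu0 (misfit \<Gamma> y (H \<omega>))))\<^sup>2) \<partial>P)"
      using H(2) by (intro nn_integral_cong_AE) auto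
    then show ?thesis
      using sample[OF H(1)] exponents forward_error_cong_AE[OF H(2)] by simp
  qed
  ultimately show ?thesis using C by blast
qed

end
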